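(* The braided Thompson group $BV$ does not admit non-trivial linear representations in any characteristic. That is, for every field $K$ (of any characteristic) and every integer $d\ge 1$, every group homomorphism $BV\to \mathrm{GL}_d(K)$ is trivial.
   Context: $BV$ is the braided version (due to Brin and Dehornoy) of R. Thompson's group $V$. Informally, its elements are triples (top tree, braid, bottom tree), where the trees are finite planar binary trees with the same number $n$ of leaves and the braid in $B_n$ connects the leaves of the top tree to those of the bottom tree. By a theorem of Brin, $BV$ is the group generated by three families $\nu_n,\ \bar\pi_n,\ \pi_n$ ($n\ge 0$) subject to the relations: - $\nu_q\nu_m=\nu_m\nu_{q+1}$ for $m<q$; - $\pi_m^{\varepsilon}\nu_m=\nu_{m+1}\pi_m^{\varepsilon}\pi_{m+1}^{\varepsilon}$ for $m\ge 0$, $\varepsilon=\pm1$; - $\pi_q\nu_m=\nu_m\pi_q$ for $m>q+1$; - $\bar\pi_q\nu_m=\nu_m\bar\pi_{q+1}$ for $m<q$; - $\pi_m=\bar\pi_{m+1}^{-1}\nu_m^{-1}\bar\pi_m$ for $m\ge 0$; - $\pi_q\pi_m=\pi_m\pi_q$ for $|m-q|\ge 2$; - $\pi_m\pi_{m+1}\pi_m=\pi_{m+1}\pi_m\pi_{m+1}$ for $m\ge 0$; - $\bar\pi_q\pi_m=\pi_m\bar\pi_q$ for $q\ge m+2$; - $\pi_m\bar\pi_{m+1}\pi_m=\bar\pi_{m+1}\pi_m\bar\pi_{m+1}$ for $m\ge 0$; - $\pi_n=\bar\pi_n\nu_n\bar\pi_{n+1}^{-1}$ for $n\ge 0$. 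*)

theory Defs
  imports "Jordan_Normal_Form.Matrix"
begin

section \<open>Groups given by generators and relations\<close>

text \<open>A letter \<open>(s, True)\<close> stands for the generator \<open>s\<close>, and \<open>(s, False)\<close> for its formal inverse.\<close>

type_synonym 'g word = "('g \<times> bool) list"

text \<open>The least congruence on words that contains all free cancellations and the relations
  \<open>u = v\<close> for \<open>(u, v) \<in> R\<close>.\<close>

inductive_set word_cong :: "('g word \<times> 'g word) set \<Rightarrow> ('g word \<times> 'g word) set"
  for R :: "('g word \<times> 'g word) set" where
  rel: "(u, v) \<in> R \<Longrightarrow> (u, v) \<in> word_cong R"
| cancel: "([(s, b), (s, \<not> b)], []) \<in> word_cong R"
| refl: "(u, u) \<in> word_cong R"
| sym: "(u, v) \<in> word_cong R \<Longrightarrow> (v, u) \<in> word_cong R"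
| trans: "(u, v) \<in> word_cong R \<Longrightarrow> (v, w) \<in> word_cong R \<Longrightarrow> (u, w) \<in> word_cong R"
| append: "(u, u') \<in> word_cong R \<Longrightarrow> (v, v') \<in> word_cong R \<Longrightarrow> (u @ v, u' @ v') \<in> word_cong R"

definition presented_group :: "('g word \<times> 'g word) set \<Rightarrow> 'g word set monoid" where
  "presented_group R =
     \<lparr>carrier = UNIV // word_cong R,
      mult = (\<lambda>A B. \<Union>u\<in>A. \<Union>v\<in>B. word_cong R `` {u @ v}),
      one = word_cong R `` {[]}\<rparr>"

lemma equiv_word_cong: "equiv UNIV (word_cong R)"
proof (rule equivI)
  show "refl (word_cong R)" by (rule refl_onI) (rule word_cong.refl)
  show "sym (word_cong R)" by (rule symI) (rule word_cong.sym)
  show "trans (word_cong R)" by (rule transI) (rule word_cong.trans)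
qed simp

lemma word_cong_class_eq_iff:
  "word_cong R `` {u} = word_cong R `` {v} \<longleftrightarrow> (u, v) \<in> word_cong R"
  using eq_equiv_class_iff[OF equiv_word_cong] by blast

lemma mult_presented_group:
  "word_cong R `` {u} \<otimes>\<^bsub>presented_group R\<^esub> word_cong R `` {v} = word_cong R `` {u @ v}"
proof -
  have "(\<Union>u'\<in>word_cong R `` {u}. \<Union>v'\<in>word_cong R `` {v}. word_cong R `` {u' @ v'}) =
      (\<Union>u'\<in>word_cong R `` {u}. \<Union>v'\<in>word_cong R `` {v}. word_cong R `` {u @ v})"
    by (intro SUP_cong HOL.refl, unfold word_cong_class_eq_iff)
      (simp only: Image_singleton_iff word_cong.sym word_cong.append)
  also have "\<dots> = word_cong R `` {u @ v}"
    using word_cong.refl[of u R] word_cong.refl[of v R] by blast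
  finally show ?thesis
    by (simp add: presented_group_def)
qed

lemma one_presented_group: "\<one>\<^bsub>presented_group R\<^esub> = word_cong R `` {[]}"
  by (simp add: presented_group_def)

lemma carrier_presented_group: "carrier (presented_group R) = range (\<lambda>u. word_cong R `` {u})"
  by (auto simp: presented_group_def quotient_def)

lemma word_cong_inverse:
  "(rev (map (\<lambda>(s, b). (s, \<not> b)) w) @ w, []) \<in> word_cong R"
proof (induction w)
  case Nil
  show ?case by (simp add: word_cong.refl)
next
  case (Cons l w)
  obtain s b where l: "l = (s, b)" by (cases l)
  let ?i = "rev (map (\<lambda>(s, b). (s, \<not> b)) w)"
  have "([(s, \<not> b), (s, \<not> \<not> b)], []) \<in> word_cong R"
    by (rule word_cong.cancel)
  then have "(?i @ ([(s, \<not> b), (s, b)] @ w), ?i @ ([] @ w)) \<in> word_cong R"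
    by (intro word_cong.append word_cong.refl) simp
  then show ?case
    using word_cong.trans[OF _ Cons.IH] by (simp add: l)
qed

lemma group_presented_group: "group (presented_group R)"
proof (rule groupI)
  fix x assume "x \<in> carrier (presented_group R)"
  then obtain w where w: "x = word_cong R `` {w}"
    by (auto simp: carrier_presented_group)
  show "\<exists>y\<in>carrier (presented_group R). y \<otimes>\<^bsub>presented_group R\<^esub> x = \<one>\<^bsub>presented_group R\<^esub>"
    by (rule bexI[where x = "word_cong R `` {rev (map (\<lambda>(s, b). (s, \<not> b)) w)}"])
      (auto simp: w mult_presented_group one_presented_group carrier_presented_group
        word_cong_class_eq_iff word_cong_inverse)
next
  fix x y z
  assume "x \<in> carrier (presented_group R)" "y \<in> carrier (presented_group R)"
    "z \<in> carrier (presented_group R)"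
  then obtain u v w where "x = word_cong R `` {u}" "y = word_cong R `` {v}" "z = word_cong R `` {w}"
    unfolding carrier_presented_group by blast
  then show "x \<otimes>\<^bsub>presented_group R\<^esub> y \<otimes>\<^bsub>presented_group R\<^esub> z =
      x \<otimes>\<^bsub>presented_group R\<^esub> (y \<otimes>\<^bsub>presented_group R\<^esub> z)"
    by (simp only: mult_presented_group append_assoc)
qed (unfold carrier_presented_group one_presented_group,
    auto simp only: mult_presented_group append_Nil intro: rangeI)

section \<open>The braided Thompson group\<close>

datatype BV_gen = GNu nat | GPiBar nat | GPi nat

definition gen :: "'g \<Rightarrow> 'g word" where "gen s = [(s, True)]"

definition ginv :: "'g \<Rightarrow> 'g word" where "ginv s = [(s, False)]"

text \<open>In the second family of relations the sign \<open>\<epsilon> = \<plusminus>1\<close> is the Boolean \<open>e\<close>.\<close>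

definition BV_relations :: "(BV_gen word \<times> BV_gen word) set" where
  "BV_relations =
     {(gen (GNu q) @ gen (GNu m), gen (GNu m) @ gen (GNu (q + 1))) | q m. m < q}
   \<union> {([(GPi m, e)] @ gen (GNu m), gen (GNu (m + 1)) @ [(GPi m, e)] @ [(GPi (m + 1), e)]) | m e. True}
   \<union> {(gen (GPi q) @ gen (GNu m), gen (GNu m) @ gen (GPi q)) | q m. m > q + 1}
   \<union> {(gen (GPiBar q) @ gen (GNu m), gen (GNu m) @ gen (GPiBar (q + 1))) | q m. m < q}
   \<union> {(gen (GPi m), ginv (GPiBar (m + 1)) @ ginv (GNu m) @ gen (GPiBar m)) | m. True}
   \<union> {(gen (GPi q) @ gen (GPi m), gen (GPi m) @ gen (GPi q)) | q m. \<bar>int m - int q\<bar> \<ge> 2}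
   \<union> {(gen (GPi m) @ gen (GPi (m + 1)) @ gen (GPi m),
       gen (GPi (m + 1)) @ gen (GPi m) @ gen (GPi (m + 1))) | m. True}
   \<union> {(gen (GPiBar q) @ gen (GPi m), gen (GPi m) @ gen (GPiBar q)) | q m. q \<ge> m + 2}
   \<union> {(gen (GPi m) @ gen (GPiBar (m + 1)) @ gen (GPi m),
       gen (GPiBar (m + 1)) @ gen (GPi m) @ gen (GPiBar (m + 1))) | m. True}
   \<union> {(gen (GPi n), gen (GPiBar n) @ gen (GNu n) @ ginv (GPiBar (n + 1))) | n. True}"

definition BV :: "BV_gen word set monoid" where
  "BV = presented_group BV_relations"

lemma group_BV: "group BV"
  unfolding BV_def by (rule group_presented_group)

section \<open>General linear groups\<close>

definition GL :: "'k::field itself \<Rightarrow> nat \<Rightarrow> 'k mat monoid" where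
  "GL K d = units_of (ring_mat TYPE('k) d ())"

lemma group_GL: "group (GL K d)"
  unfolding GL_def by (intro monoid.units_group ring.is_monoid ring_mat)

end

theory Submission
  imports Defs "Jordan_Normal_Form.Determinant"
begin

text \<open>
  The proof uses only one consequence of linearity, a finiteness condition on centralizers:
  every sequence \<open>z\<^sub>0, z\<^sub>1, \<dots>\<close> in \<open>GL\<^sub>d(K)\<close> has a member \<open>z\<^sub>j\<close> that commutes with everything that
  commutes with all of \<open>z\<^sub>0, \<dots>, z\<^sub>j\<^sub>-\<^sub>1\<close>. The reason is that \<open>d\<^sup>2 + 1\<close> matrices are linearly dependent,
  so that some \<open>z\<^sub>j\<close> is a linear combination of its predecessors (\<open>mat_bicommutant\<close>).

  Write \<open>N\<^sub>k\<close>, \<open>P\<^sub>k\<close>, \<open>Q\<^sub>k\<close> for the images of the generators \<open>GNu k\<close>, \<open>GPi k\<close>, \<open>GPiBar k\<close>. Conjugation by \<open>N\<^sub>0\<close> shifts the sequence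
  \<open>N\<^sub>1, N\<^sub>2, \<dots>\<close> by one place. Hence the centralizers of its tails form an ascending chain of
  conjugate subgroups, and the finiteness condition forces them to coincide
  (\<open>commutes_with_shifted_head\<close>). Now \<open>P\<^sub>q\<close> commutes with \<open>N\<^sub>m\<close> for \<open>m > q + 1\<close>, so it commutes with
  \<open>N\<^sub>m\<close> for every \<open>m \<ge> 1\<close>. The relation \<open>P\<^sub>m N\<^sub>m = N\<^sub>m\<^sub>+\<^sub>1 P\<^sub>m P\<^sub>m\<^sub>+\<^sub>1\<close> then reads \<open>N\<^sub>m = N\<^sub>m\<^sub>+\<^sub>1 P\<^sub>m\<^sub>+\<^sub>1\<close> for \<open>m \<ge> 1\<close>, so that
  \<open>N\<^sub>m\<close> and \<open>N\<^sub>m\<^sub>+\<^sub>1\<close> commute; together with \<open>N\<^sub>m\<^sub>+\<^sub>1 N\<^sub>m = N\<^sub>m N\<^sub>m\<^sub>+\<^sub>2\<close> this gives \<open>N\<^sub>m\<^sub>+\<^sub>1 = N\<^sub>m\<^sub>+\<^sub>2\<close>, and so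
  \<open>P\<^sub>q = 1\<close> for large \<open>q\<close>. From there the collapse spreads: the braid relations kill
  all \<open>P\<^sub>q\<close>, the mixed braid relations make \<open>Q\<^sub>m\<^sub>+\<^sub>1\<close> idempotent, and the last family of relations
  kills \<open>N\<close> and \<open>Q\<^sub>0\<close> (\<open>BV_relations_collapse\<close>).
\<close>

section \<open>Linear dependence and centralizers of matrices\<close>

text \<open>Padding the \<open>D \<times> (D + 1)\<close> coefficient matrix with a zero row gives a square matrix of
  determinant zero, whose kernel supplies the coefficients.\<close>

lemma linear_dependence:
  fixes f :: "nat \<Rightarrow> nat \<Rightarrow> 'k::field"
  shows "\<exists>c. (\<exists>i\<le>D. c i \<noteq> 0) \<and> (\<forall>r<D. (\<Sum>i\<le>D. c i * f i r) = 0)"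
proof -
  let ?A = "mat (Suc D) (Suc D) (\<lambda>(r, i). if r < D then f i r else 0)"
  have A: "?A \<in> carrier_mat (Suc D) (Suc D)" by simp
  then have AT: "?A\<^sup>T \<in> carrier_mat (Suc D) (Suc D)" by (rule transpose_carrier_mat[THEN iffD2])
  have "?A\<^sup>T *\<^sub>v unit_vec (Suc D) D = 0\<^sub>v (Suc D)"
    by (rule eq_vecI) (auto simp: scalar_prod_right_unit)
  moreover have "unit_vec (Suc D) D \<noteq> (0\<^sub>v (Suc D) :: 'k vec)"
    by simp
  ultimately have "det ?A\<^sup>T = 0"
    unfolding det_0_iff_vec_prod_zero_field[OF AT]
    by (intro exI[of _ "unit_vec (Suc D) D"] conjI unit_vec_carrier)
  then have "det ?A = 0"
    using det_transpose[OF A] by simp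
  then obtain v where v: "v \<in> carrier_vec (Suc D)" "v \<noteq> 0\<^sub>v (Suc D)" "?A *\<^sub>v v = 0\<^sub>v (Suc D)"
    using det_0_iff_vec_prod_zero_field[OF A] by blast
  have "\<exists>i<Suc D. v $ i \<noteq> 0"
  proof (rule ccontr)
    assume "\<not> (\<exists>i<Suc D. v $ i \<noteq> 0)"
    then have "v = 0\<^sub>v (Suc D)" using v(1) by (intro eq_vecI) auto
    with v(2) show False by contradiction
  qed
  moreover have "(\<Sum>i\<le>D. v $ i * f i r) = 0" if "r < D" for r
  proof -
    have "0 = (?A *\<^sub>v v) $ r" using v(3) that by simp
    also have "\<dots> = (\<Sum>i\<le>D. v $ i * f i r)"
      using that v(1) by (simp add: scalar_prod_def mult.commute atLeast0LessThan flip: lessThan_Suc_atMost)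
    finally show ?thesis by simp
  qed
  ultimately show ?thesis
    by (intro exI[of _ "\<lambda>i. v $ i"]) (auto simp: less_Suc_eq_le)
qed

text \<open>The index \<open>j\<close> is the last one that occurs in a linear dependence of the \<open>d\<^sup>2 + 1\<close> matrices
  \<open>Z 0, \<dots>, Z (d * d)\<close>, so \<open>Z j\<close> is a linear combination of its predecessors; and commuting
  with \<open>B\<close> is a linear condition.\<close>

lemma mat_bicommutant:
  fixes Z :: "nat \<Rightarrow> 'k::field mat"
  assumes Z: "\<And>i. Z i \<in> carrier_mat d d"
  shows "\<exists>j. \<forall>B\<in>carrier_mat d d. (\<forall>i<j. Z i * B = B * Z i) \<longrightarrow> Z j * B = B * Z j"
proof -
  \<comment> \<open>Entry \<open>(r, t)\<close> of a matrix is listed at position \<open>r * d + t\<close>.\<close>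
  obtain c where c0: "\<exists>i\<le>d*d. c i \<noteq> 0"
    and c: "\<And>k. k < d*d \<Longrightarrow> (\<Sum>i\<le>d*d. c i * (Z i $$ (k div d, k mod d))) = 0"
    using linear_dependence[of "d*d" "\<lambda>i k. Z i $$ (k div d, k mod d)"] by blast
  have dep: "(\<Sum>i\<le>d*d. c i * Z i $$ (r, t)) = 0" if "r < d" "t < d" for r t
  proof -
    have "r * d + t < Suc r * d" using that by simp
    also have "\<dots> \<le> d * d" using that by (intro mult_le_mono) auto
    finally show ?thesis using c[of "r * d + t"] that by simp
  qed
  define j where "j = Max {i. i \<le> d*d \<and> c i \<noteq> 0}"
  have "j \<in> {i. i \<le> d*d \<and> c i \<noteq> 0}"
    unfolding j_def by (rule Max_in) (use c0 in auto)
  then have j: "j \<le> d*d" "c j \<noteq> 0" by auto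
  have above: "c i = 0" if "i \<le> d*d" "j < i" for i
  proof (rule ccontr)
    assume "c i \<noteq> 0"
    then have "i \<le> j" unfolding j_def using that(1) by (intro Max_ge) auto
    with that(2) show False by simp
  qed
  show ?thesis
  proof (intro exI ballI impI)
    fix B :: "'k mat"
    assume B: "B \<in> carrier_mat d d" and comm: "\<forall>i<j. Z i * B = B * Z i"
    show "Z j * B = B * Z j"
    proof (rule eq_matI)
      fix r s assume "r < dim_row (B * Z j)" "s < dim_col (B * Z j)"
      then have rs: "r < d" "s < d" using B Z[of j] by auto
      let ?e = "\<lambda>i. (Z i * B) $$ (r, s) - (B * Z i) $$ (r, s)"
      have e: "?e i = (\<Sum>t<d. Z i $$ (r, t) * B $$ (t, s)) - (\<Sum>t<d. B $$ (r, t) * Z i $$ (t, s))" for i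
        using B Z[of i] rs by (simp add: scalar_prod_def lessThan_atLeast0)
      have "(\<Sum>i\<le>d*d. c i * ?e i)
          = (\<Sum>t<d. (\<Sum>i\<le>d*d. c i * Z i $$ (r, t)) * B $$ (t, s))
            - (\<Sum>t<d. B $$ (r, t) * (\<Sum>i\<le>d*d. c i * Z i $$ (t, s)))"
        unfolding e right_diff_distrib sum_subtractf sum_distrib_left sum_distrib_right
        by (subst (1 2) sum.swap) (simp add: mult_ac)
      also have "\<dots> = 0" using dep rs by simp
      finally have "(\<Sum>i\<le>d*d. c i * ?e i) = 0" .
      moreover have "(\<Sum>i\<le>d*d. c i * ?e i) = (\<Sum>i\<in>{j}. c i * ?e i)"
      proof (rule sum.mono_neutral_right)
        show "\<forall>i\<in>{..d*d} - {j}. c i * ?e i = 0"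
        proof
          fix i assume i: "i \<in> {..d*d} - {j}"
          then consider "i < j" | "j < i" by force
          then show "c i * ?e i = 0"
          proof cases
            case 1
            then show ?thesis using comm by simp
          next
            case 2
            then show ?thesis using above i by simp
          qed
        qed
      qed (use j in auto)
      ultimately show "(Z j * B) $$ (r, s) = (B * Z j) $$ (r, s)" using j(2) by simp
    qed (use B Z[of j] in auto)
  qed
qed

section \<open>Groups with the centralizer condition\<close>

text \<open>The centralizers of \<open>{z\<^sub>0, \<dots>, z\<^sub>j\<^sub>-\<^sub>1}\<close> form a descending chain as \<open>j\<close> grows; the condition asks that
  at least one step of the chain is an equality. It is a weak form of the chain condition on
  centralizers that holds in every linear group.\<close>

locale centralizer_group = group +
  assumes bicommutant: "(\<And>i::nat. z i \<in> carrier G) \<Longrightarrow>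
    \<exists>j. \<forall>b\<in>carrier G. (\<forall>i<j. z i \<otimes> b = b \<otimes> z i) \<longrightarrow> z j \<otimes> b = b \<otimes> z j"
begin

text \<open>Put \<open>z\<^sub>i = a\<^sup>-\<^sup>i x a\<^sup>i\<close>, which commutes with \<open>b\<^sub>k\<close> for \<open>k > i\<close>. All of \<open>z\<^sub>0, \<dots>, z\<^sub>j\<^sub>-\<^sub>1\<close> commute with
  \<open>b\<^sub>j\<close>, hence for a suitable \<open>j\<close> so does \<open>z\<^sub>j\<close>; conjugating back by \<open>a\<^sup>j\<close> turns this into the claim.\<close>

lemma commutes_with_shifted_head:
  assumes a: "a \<in> carrier G" and x: "x \<in> carrier G" and b: "\<And>k::nat. b k \<in> carrier G"
    and shift: "\<And>k. b k \<otimes> a = a \<otimes> b (Suc k)"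
    and tail: "\<And>k. x \<otimes> b (Suc k) = b (Suc k) \<otimes> x"
  shows "x \<otimes> b 0 = b 0 \<otimes> x"
proof -
  define z where "z = rec_nat x (\<lambda>_ y. inv a \<otimes> y \<otimes> a)"
  have z0: "z 0 = x" and zS: "\<And>i. z (Suc i) = inv a \<otimes> z i \<otimes> a"
    by (simp_all add: z_def)
  have z: "z i \<in> carrier G" for i
    by (induction i) (use a x in \<open>simp_all add: z0 zS\<close>)
  have bS: "b (Suc k) = inv a \<otimes> b k \<otimes> a" for k
  proof -
    have "inv a \<otimes> b k \<otimes> a = inv a \<otimes> (a \<otimes> b (Suc k))"
      using a b by (simp add: m_assoc shift)
    also have "\<dots> = b (Suc k)"
      using a b by (simp flip: m_assoc)
    finally show ?thesis by simp
  qed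
  have cancel: "a \<otimes> (inv a \<otimes> g) = g" if "g \<in> carrier G" for g
    using a that by (simp flip: m_assoc)
  have conj_mult: "(inv a \<otimes> g \<otimes> a) \<otimes> (inv a \<otimes> h \<otimes> a) = inv a \<otimes> (g \<otimes> h) \<otimes> a"
    if "g \<in> carrier G" "h \<in> carrier G" for g h
    using a that by (simp add: m_assoc cancel)
  have step: "z (Suc i) \<otimes> b (Suc k) = b (Suc k) \<otimes> z (Suc i) \<longleftrightarrow> z i \<otimes> b k = b k \<otimes> z i" for i k
    unfolding zS bS conj_mult[OF z b] conj_mult[OF b z] using z b a by simp
  have ahead: "z i \<otimes> b (Suc (i + k)) = b (Suc (i + k)) \<otimes> z i" for i k
    by (induction i) (use tail in \<open>simp_all add: z0 step\<close>)
  obtain j where "\<And>c. c \<in> carrier G \<Longrightarrow> (\<And>i. i < j \<Longrightarrow> z i \<otimes> c = c \<otimes> z i) \<Longrightarrow> z j \<otimes> c = c \<otimes> z j"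
    using bicommutant[of z] z by blast
  moreover have "z i \<otimes> b j = b j \<otimes> z i" if "i < j" for i
    using ahead[of i "j - Suc i"] that by simp
  ultimately have "z j \<otimes> b j = b j \<otimes> z j"
    using b by blast
  moreover have "z i \<otimes> b i = b i \<otimes> z i \<Longrightarrow> x \<otimes> b 0 = b 0 \<otimes> x" for i
    by (induction i) (simp_all add: z0 step)
  ultimately show ?thesis by blast
qed

lemma BV_relations_collapse:
  fixes N Q P :: "nat \<Rightarrow> 'a"
  assumes N: "\<And>n. N n \<in> carrier G" and Q: "\<And>n. Q n \<in> carrier G" and P: "\<And>n. P n \<in> carrier G"
    and NN: "\<And>m q. m < q \<Longrightarrow> N q \<otimes> N m = N m \<otimes> N (Suc q)"
    and PN: "\<And>m. P m \<otimes> N m = N (Suc m) \<otimes> (P m \<otimes> P (Suc m))"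
    and PN_far: "\<And>m q. q + 1 < m \<Longrightarrow> P q \<otimes> N m = N m \<otimes> P q"
    and PPP: "\<And>m. P m \<otimes> (P (Suc m) \<otimes> P m) = P (Suc m) \<otimes> (P m \<otimes> P (Suc m))"
    and PQP: "\<And>m. P m \<otimes> (Q (Suc m) \<otimes> P m) = Q (Suc m) \<otimes> (P m \<otimes> Q (Suc m))"
    and PQNQ: "\<And>n. P n = Q n \<otimes> (N n \<otimes> inv (Q (Suc n)))"
  shows "N n = \<one>" "Q n = \<one>" "P n = \<one>"
proof -
  \<comment> \<open>Downward induction on the start of the tail, from \<open>q + 2\<close>, where the far commutation relation
    holds, to \<open>1\<close>.\<close>
  have PN_tail: "P q \<otimes> N (Suc n + k) = N (Suc n + k) \<otimes> P q" if "n \<le> Suc q" for q n k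
    using that
  proof (induction n arbitrary: k rule: inc_induct)
    case base
    show ?case by (rule PN_far) simp
  next
    case (step n)
    show ?case
    proof (cases k)
      case 0
      \<comment> \<open>The head is \<open>N (Suc n)\<close> with a positive index: \<open>N 0\<close> does not shift itself to \<open>N 1\<close>.\<close>
      have "P q \<otimes> N (Suc n + 0) = N (Suc n + 0) \<otimes> P q"
      proof (rule commutes_with_shifted_head[of "N 0" "P q" "\<lambda>k. N (Suc n + k)"])
        show "N (Suc n + k) \<otimes> N 0 = N 0 \<otimes> N (Suc n + Suc k)" for k
          using NN[of 0 "Suc n + k"] by simp
        show "P q \<otimes> N (Suc n + Suc k) = N (Suc n + Suc k) \<otimes> P q" for k
          using step.IH[of k] by simp
      qed (use N P in auto)
      with 0 show ?thesis by simp
    next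
      case (Suc k')
      then show ?thesis using step.IH[of k'] by simp
    qed
  qed
  have PN_comm: "P q \<otimes> N (Suc m) = N (Suc m) \<otimes> P q" for q m
    using PN_tail[of 0 q m] by simp
  have N_P: "N (Suc m) = N (Suc (Suc m)) \<otimes> P (Suc (Suc m))" for m
  proof -
    have "P (Suc m) \<otimes> N (Suc m) = N (Suc (Suc m)) \<otimes> (P (Suc m) \<otimes> P (Suc (Suc m)))"
      by (rule PN)
    also have "\<dots> = P (Suc m) \<otimes> (N (Suc (Suc m)) \<otimes> P (Suc (Suc m)))"
      using N P by (simp add: PN_comm flip: m_assoc)
    finally show ?thesis using N P by simp
  qed
  have N_const: "N (Suc (Suc m)) = N (Suc (Suc (Suc m)))" for m
  proof -
    have "N (Suc m) \<otimes> N (Suc (Suc (Suc m))) = N (Suc (Suc m)) \<otimes> N (Suc m)"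
      using NN[of "Suc m" "Suc (Suc m)"] by simp
    also have "\<dots> = N (Suc m) \<otimes> N (Suc (Suc m))"
      using N P by (simp add: N_P[of m] PN_comm m_assoc)
    finally show ?thesis using N by simp
  qed
  have P_far: "P (Suc (Suc (Suc m))) = \<one>" for m
  proof -
    have "N (Suc (Suc (Suc m))) = N (Suc (Suc (Suc m))) \<otimes> P (Suc (Suc (Suc m)))"
      using N_P[of "Suc m"] N_const[of m] by (rule back_subst)
    then show ?thesis using N P by simp
  qed
  have P_down: "P m = \<one>" if "P (Suc m) = \<one>" for m
    using PPP[of m] that P by simp
  have P1: "P n = \<one>" for n
    using P_down[OF P_down[OF P_down[OF P_far]]] by blast
  have N_Suc: "N (Suc m) = N m" for m
    using PN[of m] by (simp add: P1 N)
  have N_eq: "N n = N 0" for n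
    by (induction n) (simp_all only: N_Suc)
  have Q_Suc: "Q (Suc m) = \<one>" for m
    using PQP[of m] Q by (simp add: P1)
  have N1: "N n = \<one>" for n
    using PQNQ[of 1] N_eq[of 1] N_eq[of n] N by (simp add: P1 Q_Suc)
  have "Q 0 = \<one>"
    using PQNQ[of 0] Q by (simp add: P1 Q_Suc N1)
  then show "N n = \<one>" "Q n = \<one>" "P n = \<one>"
    using N1 P1 Q_Suc by (cases n; simp)+
qed

end

section \<open>The general linear group\<close>

lemma mult_GL [simp]: "A \<otimes>\<^bsub>GL TYPE('k::field) d\<^esub> B = A * B"
  by (simp add: GL_def units_of_def ring_mat_def)

lemma carrier_GL_subset: "carrier (GL TYPE('k::field) d) \<subseteq> carrier_mat d d"
  by (auto simp: GL_def units_of_def Units_def ring_mat_def)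

lemma centralizer_group_GL: "centralizer_group (GL TYPE('k::field) d)"
proof -
  interpret group "GL TYPE('k) d" by (rule group_GL)
  show ?thesis
  proof
    fix z :: "nat \<Rightarrow> 'k mat"
    assume "\<And>i. z i \<in> carrier (GL TYPE('k) d)"
    then have "\<And>i. z i \<in> carrier_mat d d" using carrier_GL_subset by blast
    from mat_bicommutant[of z, OF this]
    show "\<exists>j. \<forall>b\<in>carrier (GL TYPE('k) d).
        (\<forall>i<j. z i \<otimes>\<^bsub>GL TYPE('k) d\<^esub> b = b \<otimes>\<^bsub>GL TYPE('k) d\<^esub> z i) \<longrightarrow>
        z j \<otimes>\<^bsub>GL TYPE('k) d\<^esub> b = b \<otimes>\<^bsub>GL TYPE('k) d\<^esub> z j"
      using carrier_GL_subset unfolding mult_GL by blast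
  qed
qed

section \<open>Homomorphisms from a presented group\<close>

locale presented_group_hom =
  group_hom "presented_group R" G h for R :: "('g word \<times> 'g word) set" and G (structure) and h
begin

definition ev :: "'g word \<Rightarrow> 'a" where "ev w = h (word_cong R `` {w})"

lemma ev_closed [simp]: "ev w \<in> carrier G"
  by (simp add: ev_def carrier_presented_group)

lemma ev_append: "ev (u @ v) = ev u \<otimes> ev v"
proof -
  have "h (word_cong R `` {u} \<otimes>\<^bsub>presented_group R\<^esub> word_cong R `` {v}) = ev u \<otimes> ev v"
    unfolding ev_def by (rule hom_mult) (simp_all add: carrier_presented_group)
  then show ?thesis by (simp add: mult_presented_group ev_def)
qed

lemma ev_Nil: "ev [] = \<one>"
  using hom_one by (simp add: ev_def one_presented_group)

lemma ev_cong: "(u, v) \<in> word_cong R \<Longrightarrow> ev u = ev v"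
  by (simp add: ev_def flip: word_cong_class_eq_iff)

lemma ev_ginv: "ev (ginv s) = inv (ev (gen s))"
proof -
  have "ev (ginv s @ gen s) = ev []"
    using word_cong.cancel[of s False R] by (intro ev_cong) (simp add: ginv_def gen_def)
  then have "ev (ginv s) \<otimes> ev (gen s) = \<one>"
    by (simp add: ev_append ev_Nil)
  then show ?thesis
    by (simp add: H.inv_equality)
qed

lemma trivial_if_trivial_on_generators:
  assumes "\<And>s. ev (gen s) = \<one>" and "x \<in> carrier (presented_group R)"
  shows "h x = \<one>"
proof -
  obtain w where "x = word_cong R `` {w}"
    using assms(2) by (auto simp: carrier_presented_group)
  then have "h x = ev w" by (simp add: ev_def)
  also have "ev w = \<one>"
  proof (induction w)
    case (Cons l w)
    have "ev [l] = \<one>"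
    proof (cases l)
      case (Pair s e)
      then show ?thesis
        using assms(1)[of s] ev_ginv[of s] by (cases e) (simp_all add: gen_def ginv_def)
    qed
    then show ?case using ev_append[of "[l]" w] Cons by simp
  qed (rule ev_Nil)
  finally show ?thesis .
qed

end

section \<open>Linear representations of the braided Thompson group\<close>

theorem mainTheorem1:
  fixes d :: nat and \<rho> :: "BV_gen word set \<Rightarrow> 'k::field mat"
  assumes "d \<ge> 1"
    and "\<rho> \<in> hom BV (GL TYPE('k) d)"
  shows "\<forall>x\<in>carrier BV. \<rho> x = \<one>\<^bsub>GL TYPE('k) d\<^esub>"
proof -
  let ?G = "GL TYPE('k) d"
  interpret C: centralizer_group ?G by (rule centralizer_group_GL)
  interpret presented_group_hom BV_relations ?G \<rho>
    unfolding presented_group_hom_def group_hom_def group_hom_axioms_def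
    using assms(2) by (simp add: BV_def group_presented_group C.is_group)
  have ev_rel: "(u, v) \<in> BV_relations \<Longrightarrow> ev u = ev v" for u v
    by (intro ev_cong word_cong.rel)
  let ?N = "\<lambda>n. ev (gen (GNu n))" and ?Q = "\<lambda>n. ev (gen (GPiBar n))" and ?P = "\<lambda>n. ev (gen (GPi n))"
  have "(gen (GNu q) @ gen (GNu m), gen (GNu m) @ gen (GNu (Suc q))) \<in> BV_relations"
    if "m < q" for m q
    using that unfolding BV_relations_def by auto
  note NN = ev_rel[OF this, unfolded ev_append]
  have "(gen (GPi m) @ gen (GNu m), gen (GNu (Suc m)) @ gen (GPi m) @ gen (GPi (Suc m)))
      \<in> BV_relations" for m
    unfolding BV_relations_def by (auto simp: gen_def)
  note PN = ev_rel[OF this, unfolded ev_append]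
  have "(gen (GPi q) @ gen (GNu m), gen (GNu m) @ gen (GPi q)) \<in> BV_relations"
    if "q + 1 < m" for m q
    using that unfolding BV_relations_def by auto
  note PN_far = ev_rel[OF this, unfolded ev_append]
  have "(gen (GPi m) @ gen (GPi (Suc m)) @ gen (GPi m),
      gen (GPi (Suc m)) @ gen (GPi m) @ gen (GPi (Suc m))) \<in> BV_relations" for m
    unfolding BV_relations_def by auto
  note PPP = ev_rel[OF this, unfolded ev_append]
  have "(gen (GPi m) @ gen (GPiBar (Suc m)) @ gen (GPi m),
      gen (GPiBar (Suc m)) @ gen (GPi m) @ gen (GPiBar (Suc m))) \<in> BV_relations" for m
    unfolding BV_relations_def by auto
  note PQP = ev_rel[OF this, unfolded ev_append]
  have "(gen (GPi n), gen (GPiBar n) @ gen (GNu n) @ ginv (GPiBar (Suc n))) \<in> BV_relations" for n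
    unfolding BV_relations_def by auto
  note PQNQ = ev_rel[OF this, unfolded ev_append ev_ginv]
  note collapse = C.BV_relations_collapse[of ?N ?Q ?P,
      OF ev_closed ev_closed ev_closed NN PN PN_far PPP PQP PQNQ]
  have "ev (gen s) = \<one>\<^bsub>?G\<^esub>" for s
    by (cases s) (simp_all only: collapse)
  then show ?thesis
    using trivial_if_trivial_on_generators by (simp add: BV_def)
qed

end
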